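(* Let $\mathbb{K}=\mathbb{R}$ or $\mathbb{K}=\mathbb{C}$, let $\Omega$ be a measure space with (positive) measure $m$, and let $f,g,h\in L^{2}(\Omega,m)$, with $f,g$ linearly independent and $$\int_{\Omega}h(x)\overline{f(x)}\,dm(x)=0,\qquad \int_{\Omega}|h(x)|^{2}\,dm(x)=1.$$ Then $$\frac{\int_{\Omega}|f(x)|^{2}dm(x)\int_{\Omega}|g(x)|^{2}dm(x)-\left|\int_{\Omega}f(x)\overline{g(x)}\,dm(x)\right|^{2}}{\int_{\Omega}|f(x)|^{2}dm(x)}\ \geq\ \left|\int_{\Omega}h(x)\overline{g(x)}\,dm(x)\right|^{2}.$$ Moreover, equality holds in this inequality if and only if there is a scalar $\nu\in\mathbb{K}$ with $$|\nu|=\frac{\left(\int_{\Omega}|f(x)|^{2}dm(x)\right)^{1/2}}{\left[\int_{\Omega}|f(x)|^{2}dm(x)\int_{\Omega}|g(x)|^{2}dm(x)-\left|\int_{\Omega}f(x)\overline{g(x)}\,dm(x)\right|^{2}\right]^{1/2}}$$ such that $$h(x)=\nu\left[g(x)-\frac{\int_{\Omega}g(y)\overline{f(y)}\,dm(y)}{\int_{\Omega}|f(y)|^{2}dm(y)}\,f(x)\right]\quad\text{for } m\text{-a.e. } x\in\Omega.$$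
   Context: $L^{2}(\Omega,m)$ is the space of $m$-measurable functions $f:\Omega\to\mathbb{K}$ with $\int_{\Omega}|f(x)|^{2}dm(x)<\infty$, functions equal $m$-almost everywhere being identified; linear independence of $f,g$ is understood in this space. *)

theory Defs
  imports "HOL-Analysis.Analysis"
begin

text \<open>Elements of \<open>L\<^sup>2\<close> are represented by functions rather than by classes of almost everywhere
  equal functions.\<close>

definition L2_space :: "'a measure \<Rightarrow> ('a \<Rightarrow> 'b::real_normed_vector) set" where
  "L2_space M = {f \<in> borel_measurable M. integrable M (\<lambda>x. (norm (f x))\<^sup>2)}"

text \<open>Linear independence of the family consisting of the classes of \<open>f\<close> and \<open>g\<close> modulo almost
  everywhere equality: the zero vector of the quotient is the class of the functions vanishing
  almost everywhere.\<close>

definition lin_indep_AE :: "'a measure \<Rightarrow> ('a \<Rightarrow> 'b::field) \<Rightarrow> ('a \<Rightarrow> 'b) \<Rightarrow> bool" where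
  "lin_indep_AE M f g \<longleftrightarrow>
     (\<forall>a b. (AE x in M. a * f x + b * g x = 0) \<longrightarrow> a = 0 \<and> b = 0)"

end

(* Let u = g - (<g,f>/<f,f>) f be the component of g orthogonal to f, so that
   |u|^2 = (|f|^2 |g|^2 - |<f,g>|^2) / |f|^2, which is positive by linear independence. As h is
   orthogonal to f, <h,g> = <h,u>. Removing from u its component along the unit vector h gives
   |u - <u,h> h|^2 = |u|^2 - |<h,u>|^2, hence the inequality, with equality iff u = <u,h> h almost
   everywhere. The real case follows from the complex one, because the scalar obtained for real
   functions is automatically real. *)

theory Submission
  imports Defs
begin

section \<open>Square-integrable functions and their inner products\<close>

lemma L2_space_measurable: "f \<in> L2_space M \<Longrightarrow> f \<in> borel_measurable M"
  by (simp add: L2_space_def)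

lemma L2_space_integrable_norm2: "f \<in> L2_space M \<Longrightarrow> integrable M (\<lambda>x. (norm (f x))\<^sup>2)"
  by (simp add: L2_space_def)

lemma borel_measurable_cnj [measurable (raw)]:
  fixes f :: "'a \<Rightarrow> complex"
  assumes "f \<in> borel_measurable M"
  shows "(\<lambda>x. cnj (f x)) \<in> borel_measurable M"
  using assms by (rule borel_measurable_continuous_on[rotated]) (intro continuous_intros)

text \<open>Domination by \<open>(norm (f x))\<^sup>2 + (norm (g x))\<^sup>2\<close>, using 2ab
  \<le> a^2 + b^2. This makes the inner products below genuine integrals, not the default value 0 of
  a non-integrable function.\<close>

lemma L2_space_integrable_mult_cnj:
  fixes f g :: "'a \<Rightarrow> complex"
  assumes f: "f \<in> L2_space M" and g: "g \<in> L2_space M"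
  shows "integrable M (\<lambda>x. f x * cnj (g x))"
proof (rule Bochner_Integration.integrable_bound)
  show "integrable M (\<lambda>x. (norm (f x))\<^sup>2 + (norm (g x))\<^sup>2)"
    using f g by (intro Bochner_Integration.integrable_add L2_space_integrable_norm2)
  have [measurable]: "f \<in> borel_measurable M" "g \<in> borel_measurable M"
    using f g by (auto intro: L2_space_measurable)
  show "(\<lambda>x. f x * cnj (g x)) \<in> borel_measurable M"
    by measurable
  have "a * b \<le> a\<^sup>2 + b\<^sup>2" if "a \<ge> 0" "b \<ge> 0" for a b :: real
    using that sum_squares_bound[of a b] mult_nonneg_nonneg[of a b] by linarith
  then show "AE x in M. norm (f x * cnj (g x)) \<le> norm ((norm (f x))\<^sup>2 + (norm (g x))\<^sup>2)"
    by (auto simp: norm_mult)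
qed

lemma L2_space_integrable_cmod2:
  fixes f :: "'a \<Rightarrow> complex"
  assumes "f \<in> L2_space M"
  shows "integrable M (\<lambda>x. (cmod (f x))\<^sup>2)"
  using L2_space_integrable_norm2[OF assms] by simp

lemma integral_cnj_mult_commute:
  fixes f g :: "'a \<Rightarrow> complex"
  shows "(\<integral>x. f x * cnj (g x) \<partial>M) = cnj (\<integral>x. g x * cnj (f x) \<partial>M)"
  by (subst Bochner_Integration.integral_cnj[symmetric]) (simp add: mult.commute del: Bochner_Integration.integral_cnj)

lemma integral_mult_cnj_self:
  fixes f :: "'a \<Rightarrow> complex"
  shows "(\<integral>x. f x * cnj (f x) \<partial>M) = complex_of_real (\<integral>x. (cmod (f x))\<^sup>2 \<partial>M)"
  by (simp flip: integral_complex_of_real complex_norm_square)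

section \<open>Norms of residuals after subtracting a multiple\<close>

lemma cmod_diff_mult_square:
  fixes a b c :: complex
  shows "(cmod (b - c * a))\<^sup>2 = (cmod b)\<^sup>2 - 2 * Re (cnj c * (b * cnj a)) + (cmod c)\<^sup>2 * (cmod a)\<^sup>2"
  by (simp only: cmod_power2) (simp add: power2_eq_square algebra_simps)

text \<open>After expansion of the square, each of the three terms is integrable, the cross term as
  the real part of a multiple of an integrable product.\<close>

lemma L2_space_diff_mult:
  fixes f g :: "'a \<Rightarrow> complex"
  assumes f: "f \<in> L2_space M" and g: "g \<in> L2_space M"
  shows "(\<lambda>x. g x - c * f x) \<in> L2_space M"
proof -
  have [measurable]: "f \<in> borel_measurable M" "g \<in> borel_measurable M"
    using f g by (auto intro: L2_space_measurable)
  have "integrable M (\<lambda>x. (cmod (g x - c * f x))\<^sup>2)"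
    unfolding cmod_diff_mult_square
    using L2_space_integrable_cmod2[OF f] L2_space_integrable_cmod2[OF g]
      L2_space_integrable_mult_cnj[OF g f]
    by (intro Bochner_Integration.integrable_add Bochner_Integration.integrable_diff
        integrable_mult_right integrable_Re) auto
  then show ?thesis
    by (simp add: L2_space_def)
qed

lemma integral_cmod_diff_mult_square:
  fixes f g :: "'a \<Rightarrow> complex"
  assumes f: "f \<in> L2_space M" and g: "g \<in> L2_space M"
  shows "(\<integral>x. (cmod (g x - c * f x))\<^sup>2 \<partial>M) =
    (\<integral>x. (cmod (g x))\<^sup>2 \<partial>M) - 2 * Re (cnj c * (\<integral>x. g x * cnj (f x) \<partial>M))
      + (cmod c)\<^sup>2 * (\<integral>x. (cmod (f x))\<^sup>2 \<partial>M)"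
proof -
  note int = L2_space_integrable_cmod2[OF f] L2_space_integrable_cmod2[OF g]
    integrable_mult_right[OF L2_space_integrable_mult_cnj[OF g f], of "cnj c"]
  have Re: "(\<integral>x. Re (cnj c * (g x * cnj (f x))) \<partial>M) = Re (cnj c * (\<integral>x. g x * cnj (f x) \<partial>M))"
    by (subst integral_Re[OF int(3)]) (simp only: integral_mult_right_zero)
  show ?thesis
    unfolding cmod_diff_mult_square
    \<comment> \<open>Each split of the integral leaves integrability goals, which are closed from
      \<open>int\<close> before the next split; linearity in the scalars then remains.\<close>
    by (subst Bochner_Integration.integral_add Bochner_Integration.integral_diff,
        (intro Bochner_Integration.integrable_diff integrable_mult_right integrable_Re int)+)+
      (simp only: Re integral_mult_right_zero)
qed

text \<open>Pythagoras: \<open>b / F\<close> is the coefficient of the orthogonal projection of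
  \<open>g\<close> onto \<open>f\<close>. The cross term contributes -2|b|^2/F and the quadratic
  term +|b|^2/F. It serves twice: to project \<open>g\<close> onto \<open>f\<close>, and later
  \<open>u\<close> onto the unit vector \<open>h\<close>.\<close>

lemma integral_cmod_residual_square:
  fixes f g :: "'a \<Rightarrow> complex" and M
  defines "F \<equiv> \<integral>x. (cmod (f x))\<^sup>2 \<partial>M"
  defines "b \<equiv> \<integral>x. g x * cnj (f x) \<partial>M"
  assumes f: "f \<in> L2_space M" and g: "g \<in> L2_space M" and nz: "F \<noteq> 0"
  shows "(\<integral>x. (cmod (g x - b / complex_of_real F * f x))\<^sup>2 \<partial>M)
    = (\<integral>x. (cmod (g x))\<^sup>2 \<partial>M) - (cmod b)\<^sup>2 / F"
proof -
  \<comment> \<open>For this choice of coefficient the argument of \<open>Re\<close> in the cross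
    term is already real.\<close>
  have eq: "cnj (b / complex_of_real F) * b = complex_of_real ((cmod b)\<^sup>2 / F)"
    using complex_norm_square[of b] by (simp add: mult.commute)
  have "(cmod (b / complex_of_real F))\<^sup>2 * F = (cmod b)\<^sup>2 / F"
    using nz by (simp add: norm_divide power_divide power2_eq_square)
  then show ?thesis
    unfolding integral_cmod_diff_mult_square[OF f g] b_def[symmetric] F_def[symmetric] eq
    by simp
qed

lemma integral_cmod_square_eq_0_iff:
  fixes f :: "'a \<Rightarrow> complex"
  assumes "f \<in> L2_space M"
  shows "(\<integral>x. (cmod (f x))\<^sup>2 \<partial>M) = 0 \<longleftrightarrow> (AE x in M. f x = 0)"
  using integral_nonneg_eq_0_iff_AE[OF L2_space_integrable_cmod2[OF assms]] by simp

section \<open>Linear independence and the complex inequality\<close>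

lemma lin_indep_AE_D1:
  assumes "lin_indep_AE M f g"
  shows "\<not> (AE x in M. f x = 0)"
  using assms[unfolded lin_indep_AE_def, rule_format, of 1 0] by auto

lemma lin_indep_AE_D2:
  assumes "lin_indep_AE M f g"
  shows "\<not> (AE x in M. g x - c * f x = 0)"
  using assms[unfolded lin_indep_AE_def, rule_format, of "- c" 1] by (auto simp: algebra_simps)

text \<open>The difference of the two sides is the squared norm of the residual of \<open>u\<close>
  along \<open>h\<close>, so equality means that this residual vanishes almost everywhere.
  Positivity of the norm of \<open>u\<close> then allows the relation to be solved for
  \<open>h\<close>.\<close>

lemma cauchy_schwarz_unit_L2:
  fixes h u :: "'a \<Rightarrow> complex"
  assumes h: "h \<in> L2_space M" and u: "u \<in> L2_space M"
    and unit: "(\<integral>x. (cmod (h x))\<^sup>2 \<partial>M) = 1"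
    and pos: "(\<integral>x. (cmod (u x))\<^sup>2 \<partial>M) > 0"
  shows "(cmod (\<integral>x. h x * cnj (u x) \<partial>M))\<^sup>2 \<le> (\<integral>x. (cmod (u x))\<^sup>2 \<partial>M)"
    and "(\<integral>x. (cmod (u x))\<^sup>2 \<partial>M) = (cmod (\<integral>x. h x * cnj (u x) \<partial>M))\<^sup>2 \<longleftrightarrow>
      (\<exists>\<nu>. cmod \<nu> = 1 / sqrt (\<integral>x. (cmod (u x))\<^sup>2 \<partial>M) \<and> (AE x in M. h x = \<nu> * u x))"
proof -
  define U where "U = (\<integral>x. (cmod (u x))\<^sup>2 \<partial>M)"
  define t where "t = (\<integral>x. u x * cnj (h x) \<partial>M)"
  have s: "(\<integral>x. h x * cnj (u x) \<partial>M) = cnj t"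
    unfolding t_def by (rule integral_cnj_mult_commute)
  \<comment> \<open>Projecting onto \<open>h\<close> rather than onto \<open>u\<close> makes the
    denominator equal to 1.\<close>
  have residual: "(\<integral>x. (cmod (u x - t * h x))\<^sup>2 \<partial>M) = U - (cmod t)\<^sup>2"
    using integral_cmod_residual_square[OF h u] unit by (simp add: U_def t_def)
  moreover have "(\<integral>x. (cmod (u x - t * h x))\<^sup>2 \<partial>M) \<ge> 0"
    by simp
  ultimately show "(cmod (\<integral>x. h x * cnj (u x) \<partial>M))\<^sup>2 \<le> (\<integral>x. (cmod (u x))\<^sup>2 \<partial>M)"
    unfolding s U_def[symmetric] by simp
  have Upos: "U > 0"
    using pos by (simp add: U_def)
  have "U = (cmod t)\<^sup>2 \<longleftrightarrow> (\<exists>\<nu>. cmod \<nu> = 1 / sqrt U \<and> (AE x in M. h x = \<nu> * u x))"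
  proof
    assume U: "U = (cmod t)\<^sup>2"
    with residual have "AE x in M. u x - t * h x = 0"
      using integral_cmod_square_eq_0_iff[OF L2_space_diff_mult[OF h u]] by simp
    moreover from U Upos have "t \<noteq> 0"
      by auto
    ultimately have "AE x in M. h x = 1 / t * u x"
      by (auto simp: field_simps)
    with U show "\<exists>\<nu>. cmod \<nu> = 1 / sqrt U \<and> (AE x in M. h x = \<nu> * u x)"
      \<comment> \<open>The relation u = t h is inverted, and |t| = sqrt U gives the prescribed
        modulus.\<close>
      by (intro exI[of _ "1 / t"]) (simp add: norm_divide)
  next
    assume "\<exists>\<nu>. cmod \<nu> = 1 / sqrt U \<and> (AE x in M. h x = \<nu> * u x)"
    then obtain \<nu> where \<nu>: "cmod \<nu> = 1 / sqrt U" and eq: "AE x in M. h x = \<nu> * u x"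
      by blast
    have [measurable]: "h \<in> borel_measurable M" "u \<in> borel_measurable M"
      using h u by (auto intro: L2_space_measurable)
    \<comment> \<open>Pairing h = \<nu> u with \<open>u\<close> yields |t| = |\<nu>| U, which is
      sqrt U by the prescribed modulus of \<nu>.\<close>
    have "cnj t = (\<integral>x. \<nu> * (u x * cnj (u x)) \<partial>M)"
      unfolding s[symmetric] using eq by (intro integral_cong_AE) (measurable, auto)
    also have "\<dots> = \<nu> * complex_of_real U"
      by (simp only: integral_mult_right_zero integral_mult_cnj_self U_def)
    finally have "cmod t = cmod \<nu> * U"
      using Upos by (metis abs_of_pos complex_mod_cnj norm_mult norm_of_real)
    with \<nu> Upos show "U = (cmod t)\<^sup>2"
      by (simp add: power_mult_distrib power_divide power2_eq_square)
  qed
  then show "(\<integral>x. (cmod (u x))\<^sup>2 \<partial>M) = (cmod (\<integral>x. h x * cnj (u x) \<partial>M))\<^sup>2 \<longleftrightarrow>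
      (\<exists>\<nu>. cmod \<nu> = 1 / sqrt (\<integral>x. (cmod (u x))\<^sup>2 \<partial>M) \<and> (AE x in M. h x = \<nu> * u x))"
    by (simp only: s U_def[symmetric] complex_mod_cnj)
qed

text \<open>This is \<open>cauchy_schwarz_unit_L2\<close> for \<open>h\<close> and the component
  \<open>u\<close> of \<open>g\<close> orthogonal to \<open>f\<close>: the quotient
  \<open>D / F\<close> is the squared norm of \<open>u\<close>, and pairing \<open>h\<close> with
  \<open>g\<close> or with \<open>u\<close> gives the same value.\<close>

lemma gram_inequality_complex:
  fixes f g h :: "'a \<Rightarrow> complex"
  assumes f: "f \<in> L2_space M" and g: "g \<in> L2_space M" and h: "h \<in> L2_space M"
    and indep: "lin_indep_AE M f g"
    and orth: "(\<integral>x. h x * cnj (f x) \<partial>M) = 0"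
    and unit: "(\<integral>x. (cmod (h x))\<^sup>2 \<partial>M) = 1"
  defines "F \<equiv> \<integral>x. (cmod (f x))\<^sup>2 \<partial>M"
  defines "D \<equiv> F * (\<integral>x. (cmod (g x))\<^sup>2 \<partial>M) - (cmod (\<integral>x. f x * cnj (g x) \<partial>M))\<^sup>2"
  shows "(cmod (\<integral>x. h x * cnj (g x) \<partial>M))\<^sup>2 \<le> D / F"
    and "D / F = (cmod (\<integral>x. h x * cnj (g x) \<partial>M))\<^sup>2 \<longleftrightarrow>
      (\<exists>\<nu>. cmod \<nu> = sqrt F / sqrt D \<and>
        (AE x in M. h x =
          \<nu> * (g x - (\<integral>y. g y * cnj (f y) \<partial>M) / complex_of_real F * f x)))"
proof -
  define c where "c = (\<integral>y. g y * cnj (f y) \<partial>M) / complex_of_real F"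
  define u where "u = (\<lambda>x. g x - c * f x)"
  have u: "u \<in> L2_space M"
    unfolding u_def by (rule L2_space_diff_mult[OF f g])
  \<comment> \<open>If \<open>F\<close> were 0, then \<open>f\<close> would be null, against linear
    independence.\<close>
  have F: "F \<noteq> 0"
    unfolding F_def using integral_cmod_square_eq_0_iff[OF f] lin_indep_AE_D1[OF indep] by simp
  \<comment> \<open>\<open>D\<close> contains the product of \<open>f\<close> with \<open>g\<close>,
    the projection coefficient that of \<open>g\<close> with \<open>f\<close>; these are conjugate,
    hence of equal modulus.\<close>
  have U: "(\<integral>x. (cmod (u x))\<^sup>2 \<partial>M) = D / F"
    using integral_cmod_residual_square[OF f g] F
    unfolding u_def c_def D_def F_def integral_cnj_mult_commute[of M f g]
    by (simp add: field_simps)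
  \<comment> \<open>A null \<open>u\<close> would be a linear relation with coefficients -c and
    1.\<close>
  have "(\<integral>x. (cmod (u x))\<^sup>2 \<partial>M) \<noteq> 0"
    using integral_cmod_square_eq_0_iff[OF u] lin_indep_AE_D2[OF indep, of c]
    by (simp add: u_def)
  then have pos: "(\<integral>x. (cmod (u x))\<^sup>2 \<partial>M) > 0"
    by (simp add: order_less_le)
  \<comment> \<open>The part of \<open>u\<close> along \<open>f\<close> enters with the factor
    \<open>cnj c\<close> and disappears by orthogonality of \<open>h\<close> and
    \<open>f\<close>.\<close>
  have "(\<integral>x. h x * cnj (u x) \<partial>M) = (\<integral>x. h x * cnj (g x) - cnj c * (h x * cnj (f x)) \<partial>M)"
    by (simp add: u_def algebra_simps)
  also have "\<dots> = (\<integral>x. h x * cnj (g x) \<partial>M)"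
    using L2_space_integrable_mult_cnj[OF h g] L2_space_integrable_mult_cnj[OF h f] orth
    by (subst Bochner_Integration.integral_diff) auto
  finally have hu: "(\<integral>x. h x * cnj (u x) \<partial>M) = (\<integral>x. h x * cnj (g x) \<partial>M)" .
  have sq: "1 / sqrt (D / F) = sqrt F / sqrt D"
    by (simp add: real_sqrt_divide)
  note cs = cauchy_schwarz_unit_L2[OF h u unit pos, unfolded hu U sq]
  show "(cmod (\<integral>x. h x * cnj (g x) \<partial>M))\<^sup>2 \<le> D / F"
    by (rule cs(1))
  show "D / F = (cmod (\<integral>x. h x * cnj (g x) \<partial>M))\<^sup>2 \<longleftrightarrow>
      (\<exists>\<nu>. cmod \<nu> = sqrt F / sqrt D \<and>
        (AE x in M. h x =
          \<nu> * (g x - (\<integral>y. g y * cnj (f y) \<partial>M) / complex_of_real F * f x)))"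
    using cs(2) by (simp only: u_def c_def)
qed

section \<open>Passage from complex to real functions\<close>

lemma L2_space_complex_of_real:
  fixes f :: "'a \<Rightarrow> real"
  assumes "f \<in> L2_space M"
  shows "(\<lambda>x. complex_of_real (f x)) \<in> L2_space M"
  using assms by (auto simp: L2_space_def)

text \<open>A complex relation between real functions splits into real and imaginary parts, each of
  which is a real relation.\<close>

lemma lin_indep_AE_complex_of_real:
  fixes f g :: "'a \<Rightarrow> real"
  assumes "lin_indep_AE M f g"
  shows "lin_indep_AE M (\<lambda>x. complex_of_real (f x)) (\<lambda>x. complex_of_real (g x))"
  unfolding lin_indep_AE_def
proof (intro allI impI)
  fix a b :: complex
  assume *: "AE x in M. a * complex_of_real (f x) + b * complex_of_real (g x) = 0"
  then have "AE x in M. Re a * f x + Re b * g x = 0" "AE x in M. Im a * f x + Im b * g x = 0"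
    by (auto simp: complex_eq_iff)
  then have "Re a = 0 \<and> Re b = 0" "Im a = 0 \<and> Im b = 0"
    using assms unfolding lin_indep_AE_def by blast+
  then show "a = 0 \<and> b = 0"
    by (simp add: complex_eq_iff)
qed

text \<open>All integrals are preserved by the embedding into the complex numbers; only the scalar
  in the equality case must be brought back to the reals.\<close>

lemma gram_inequality_real:
  fixes f g h :: "'a \<Rightarrow> real"
  assumes f: "f \<in> L2_space M" and g: "g \<in> L2_space M" and h: "h \<in> L2_space M"
    and indep: "lin_indep_AE M f g"
    and orth: "(\<integral>x. h x * f x \<partial>M) = 0"
    and unit: "(\<integral>x. \<bar>h x\<bar>\<^sup>2 \<partial>M) = 1"
  defines "F \<equiv> \<integral>x. \<bar>f x\<bar>\<^sup>2 \<partial>M"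
  defines "D \<equiv> F * (\<integral>x. \<bar>g x\<bar>\<^sup>2 \<partial>M) - \<bar>\<integral>x. f x * g x \<partial>M\<bar>\<^sup>2"
  shows "\<bar>\<integral>x. h x * g x \<partial>M\<bar>\<^sup>2 \<le> D / F"
    and "D / F = \<bar>\<integral>x. h x * g x \<partial>M\<bar>\<^sup>2 \<longleftrightarrow>
      (\<exists>\<nu>. \<bar>\<nu>\<bar> = sqrt F / sqrt D \<and>
        (AE x in M. h x = \<nu> * (g x - (\<integral>y. g y * f y \<partial>M) / F * f x)))"
proof -
  define u where "u = (\<lambda>x. g x - (\<integral>y. g y * f y \<partial>M) / F * f x)"
  have prod: "(\<integral>x. complex_of_real (p x) * cnj (complex_of_real (q x)) \<partial>M)
      = complex_of_real (\<integral>x. p x * q x \<partial>M)" for p q :: "'a \<Rightarrow> real"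
    by (simp flip: of_real_mult)
  have orth': "(\<integral>x. complex_of_real (h x) * cnj (complex_of_real (f x)) \<partial>M) = 0"
    unfolding prod orth by simp
  have unit': "(\<integral>x. (cmod (complex_of_real (h x)))\<^sup>2 \<partial>M) = 1"
    unfolding norm_of_real by (rule unit)
  note cplx = gram_inequality_complex[OF f[THEN L2_space_complex_of_real]
      g[THEN L2_space_complex_of_real] h[THEN L2_space_complex_of_real]
      lin_indep_AE_complex_of_real[OF indep] orth' unit',
      unfolded prod norm_of_real, folded F_def, folded D_def]
  show "\<bar>\<integral>x. h x * g x \<partial>M\<bar>\<^sup>2 \<le> D / F"
    by (rule cplx(1))
  have "(\<exists>\<nu>. cmod \<nu> = sqrt F / sqrt D \<and>
        (AE x in M. complex_of_real (h x) = \<nu> * complex_of_real (u x)))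
    \<longleftrightarrow> (\<exists>\<nu>. \<bar>\<nu>\<bar> = sqrt F / sqrt D \<and> (AE x in M. h x = \<nu> * u x))"
  proof
    assume "\<exists>\<nu>. cmod \<nu> = sqrt F / sqrt D \<and>
        (AE x in M. complex_of_real (h x) = \<nu> * complex_of_real (u x))"
    then obtain \<nu> where \<nu>: "cmod \<nu> = sqrt F / sqrt D"
      and eq: "AE x in M. complex_of_real (h x) = \<nu> * complex_of_real (u x)"
      by blast
    \<comment> \<open>Since \<open>h\<close> and \<open>u\<close> are real, the imaginary part of
      \<open>eq\<close> reads Im \<nu> * u = 0 almost everywhere, and \<open>u\<close> is not null
      by linear independence.\<close>
    have "Im \<nu> = 0"
    proof (rule ccontr)
      assume "Im \<nu> \<noteq> 0"
      with eq have "AE x in M. u x = 0"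
        by (auto simp: complex_eq_iff)
      then show False
        using lin_indep_AE_D2[OF indep, of "(\<integral>y. g y * f y \<partial>M) / F"] by (simp add: u_def)
    qed
    then have "\<bar>Re \<nu>\<bar> = cmod \<nu>"
      by (simp add: cmod_def)
    moreover have "AE x in M. h x = Re \<nu> * u x"
      using eq by (auto simp: complex_eq_iff)
    ultimately show "\<exists>\<nu>. \<bar>\<nu>\<bar> = sqrt F / sqrt D \<and> (AE x in M. h x = \<nu> * u x)"
      using \<nu> by metis
  next
    assume "\<exists>\<nu>. \<bar>\<nu>\<bar> = sqrt F / sqrt D \<and> (AE x in M. h x = \<nu> * u x)"
    then obtain \<nu> where "\<bar>\<nu>\<bar> = sqrt F / sqrt D" "AE x in M. h x = \<nu> * u x"
      by blast
    then show "\<exists>\<nu>. cmod \<nu> = sqrt F / sqrt D \<and>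
        (AE x in M. complex_of_real (h x) = \<nu> * complex_of_real (u x))"
      by (intro exI[of _ "complex_of_real \<nu>"]) (auto simp flip: of_real_mult)
  qed
  then show "D / F = \<bar>\<integral>x. h x * g x \<partial>M\<bar>\<^sup>2 \<longleftrightarrow>
      (\<exists>\<nu>. \<bar>\<nu>\<bar> = sqrt F / sqrt D \<and>
        (AE x in M. h x = \<nu> * (g x - (\<integral>y. g y * f y \<partial>M) / F * f x)))"
    using cplx(2) by (simp add: u_def)
qed

text \<open>The two choices of the scalar field form the two conjuncts; in the real one conjugation
  is the identity and is left out.\<close>

theorem mainTheorem3:
  fixes M :: "'a measure"
  shows
    "(\<forall>f\<in>L2_space M. \<forall>g\<in>L2_space M. \<forall>h\<in>(L2_space M :: ('a \<Rightarrow> real) set).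
        lin_indep_AE M f g \<longrightarrow>
        (\<integral>x. h x * f x \<partial>M) = 0 \<longrightarrow>
        (\<integral>x. \<bar>h x\<bar>\<^sup>2 \<partial>M) = 1 \<longrightarrow>
        ((\<integral>x. \<bar>f x\<bar>\<^sup>2 \<partial>M) * (\<integral>x. \<bar>g x\<bar>\<^sup>2 \<partial>M) - \<bar>\<integral>x. f x * g x \<partial>M\<bar>\<^sup>2)
            / (\<integral>x. \<bar>f x\<bar>\<^sup>2 \<partial>M)
          \<ge> \<bar>\<integral>x. h x * g x \<partial>M\<bar>\<^sup>2 \<and>
        (((\<integral>x. \<bar>f x\<bar>\<^sup>2 \<partial>M) * (\<integral>x. \<bar>g x\<bar>\<^sup>2 \<partial>M) - \<bar>\<integral>x. f x * g x \<partial>M\<bar>\<^sup>2)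
            / (\<integral>x. \<bar>f x\<bar>\<^sup>2 \<partial>M)
          = \<bar>\<integral>x. h x * g x \<partial>M\<bar>\<^sup>2 \<longleftrightarrow>
         (\<exists>\<nu>::real.
            \<bar>\<nu>\<bar> = sqrt (\<integral>x. \<bar>f x\<bar>\<^sup>2 \<partial>M)
              / sqrt ((\<integral>x. \<bar>f x\<bar>\<^sup>2 \<partial>M) * (\<integral>x. \<bar>g x\<bar>\<^sup>2 \<partial>M) - \<bar>\<integral>x. f x * g x \<partial>M\<bar>\<^sup>2) \<and>
            (AE x in M. h x =
               \<nu> * (g x - (\<integral>y. g y * f y \<partial>M) / (\<integral>y. \<bar>f y\<bar>\<^sup>2 \<partial>M) * f x)))))
     \<and>
     (\<forall>f\<in>L2_space M. \<forall>g\<in>L2_space M. \<forall>h\<in>(L2_space M :: ('a \<Rightarrow> complex) set).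
        lin_indep_AE M f g \<longrightarrow>
        (\<integral>x. h x * cnj (f x) \<partial>M) = 0 \<longrightarrow>
        (\<integral>x. (cmod (h x))\<^sup>2 \<partial>M) = 1 \<longrightarrow>
        ((\<integral>x. (cmod (f x))\<^sup>2 \<partial>M) * (\<integral>x. (cmod (g x))\<^sup>2 \<partial>M)
             - (cmod (\<integral>x. f x * cnj (g x) \<partial>M))\<^sup>2)
            / (\<integral>x. (cmod (f x))\<^sup>2 \<partial>M)
          \<ge> (cmod (\<integral>x. h x * cnj (g x) \<partial>M))\<^sup>2 \<and>
        (((\<integral>x. (cmod (f x))\<^sup>2 \<partial>M) * (\<integral>x. (cmod (g x))\<^sup>2 \<partial>M)
             - (cmod (\<integral>x. f x * cnj (g x) \<partial>M))\<^sup>2)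
            / (\<integral>x. (cmod (f x))\<^sup>2 \<partial>M)
          = (cmod (\<integral>x. h x * cnj (g x) \<partial>M))\<^sup>2 \<longleftrightarrow>
         (\<exists>\<nu>::complex.
            cmod \<nu> = sqrt (\<integral>x. (cmod (f x))\<^sup>2 \<partial>M)
              / sqrt ((\<integral>x. (cmod (f x))\<^sup>2 \<partial>M) * (\<integral>x. (cmod (g x))\<^sup>2 \<partial>M)
                  - (cmod (\<integral>x. f x * cnj (g x) \<partial>M))\<^sup>2) \<and>
            (AE x in M. h x =
               \<nu> * (g x - (\<integral>y. g y * cnj (f y) \<partial>M)
                        / complex_of_real (\<integral>y. (cmod (f y))\<^sup>2 \<partial>M) * f x)))))"
  by (intro conjI ballI impI)
    (rule gram_inequality_real gram_inequality_complex; assumption)+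

end
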